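(* Let $G$ be a topological group. Then $G$ is $Pm$-factorizable if and only if $G$ is feathered and $m$-factorizable.
   Context: All topological spaces (in particular all topological groups) are assumed Hausdorff. A continuous map $f:X\to Y$ is perfect if it is closed, onto, and all fibers $f^{-1}(y)$ are compact; a perfect homomorphism is a continuous group homomorphism that is a perfect map. A topological group $G$ is feathered if it contains a non-empty compact set $K$ of countable character in $G$, i.e. there is a countable family of open sets containing $K$ such that every open set containing $K$ contains a member of the family. A topological group $G$ is $m$-factorizable (respectively, $Pm$-factorizable) if for every continuous mapping $f:G\to M$ to a metrizable space $M$ there are a continuous (respectively, perfect) homomorphism $\pi:G\to K$ onto a second-countable topological group $K$ and a continuous mapping $g:K\to M$ such that $f=g\circ\pi$. *)

theory Defs
  imports "HOL-Analysis.Analysis" "HOL-Algebra.Group"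
begin

text \<open>
  All spaces are Hausdorff by convention, so this is built into the notion of topological group.
\<close>

locale topological_group = group G
  for G :: "('a, 'b) monoid_scheme" (structure) +
  fixes T :: "'a topology"
  assumes topspace_eq: "topspace T = carrier G"
    and continuous_mult: "continuous_map (prod_topology T T) T (\<lambda>(x, y). x \<otimes> y)"
    and continuous_inv: "continuous_map T T (\<lambda>x. inv x)"
    and Hausdorff: "Hausdorff_space T"

definition feathered :: "'a topology \<Rightarrow> bool"
  where "feathered T \<longleftrightarrow>
    (\<exists>C. C \<noteq> {} \<and> compactin T C \<and>
      (\<exists>\<U>. countable \<U> \<and> (\<forall>U\<in>\<U>. openin T U \<and> C \<subseteq> U) \<and>
        (\<forall>V. openin T V \<and> C \<subseteq> V \<longrightarrow> (\<exists>U\<in>\<U>. U \<subseteq> V))))"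

definition continuous_factorization ::
    "('a, 'b) monoid_scheme \<Rightarrow> 'a topology \<Rightarrow> 'm topology \<Rightarrow> ('a \<Rightarrow> 'm) \<Rightarrow>
     'k monoid \<Rightarrow> 'k topology \<Rightarrow> ('a \<Rightarrow> 'k) \<Rightarrow> ('k \<Rightarrow> 'm) \<Rightarrow> bool"
  where "continuous_factorization G T M f K S \<pi> g \<longleftrightarrow>
    topological_group K S \<and> second_countable S \<and>
    \<pi> \<in> hom G K \<and> continuous_map T S \<pi> \<and> \<pi> ` carrier G = carrier K \<and>
    continuous_map S M g \<and> (\<forall>x\<in>carrier G. f x = g (\<pi> x))"

text \<open>
  A definition cannot quantify over types, so the metrizable space \<open>M\<close> and the group \<open>K\<close> range over
  spaces and groups whose points lie in the type \<open>'a\<close> of the elements of \<open>G\<close>.  This is no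
  restriction, since only the images of \<open>f\<close> and of \<open>\<pi>\<close> matter: see the lemmas
  \<open>m_factorizable_any_type\<close>, \<open>Pm_factorizable_any_type\<close> (any type for \<open>M\<close>) and
  \<open>m_factorizableI_any_type\<close>, \<open>Pm_factorizableI_any_type\<close> (any type for \<open>K\<close>) below.
\<close>

definition m_factorizable :: "('a, 'b) monoid_scheme \<Rightarrow> 'a topology \<Rightarrow> bool"
  where "m_factorizable G T \<longleftrightarrow>
    (\<forall>(M :: 'a topology) f. metrizable_space M \<and> continuous_map T M f \<longrightarrow>
      (\<exists>(K :: 'a monoid) S \<pi> g. continuous_factorization G T M f K S \<pi> g))"

definition Pm_factorizable :: "('a, 'b) monoid_scheme \<Rightarrow> 'a topology \<Rightarrow> bool"
  where "Pm_factorizable G T \<longleftrightarrow>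
    (\<forall>(M :: 'a topology) f. metrizable_space M \<and> continuous_map T M f \<longrightarrow>
      (\<exists>(K :: 'a monoid) S \<pi> g. continuous_factorization G T M f K S \<pi> g \<and> perfect_map T S \<pi>))"

lemma homeomorphic_maps_pullback:
  assumes "\<And>y. y \<in> topspace Y \<Longrightarrow> h y \<in> A \<and> r (h y) = y"
    and "A = h ` topspace Y"
  shows "homeomorphic_maps Y (pullback_topology A r Y) h r"
proof -
  have "continuous_map (pullback_topology A r Y) Y (id \<circ> r)"
    by (intro continuous_map_pullback) simp
  moreover have "continuous_map Y (pullback_topology A r Y) h"
  proof (rule continuous_map_pullback')
    show "continuous_map Y Y (r \<circ> h)"
      by (rule continuous_map_eq [OF continuous_map_id]) (use assms in auto)
    show "topspace Y \<subseteq> h -` A"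
      using assms by auto
  qed
  ultimately show ?thesis
    unfolding homeomorphic_maps_def topspace_pullback_topology using assms by auto
qed

lemma metrizable_target_copy:
  fixes T :: "'a topology" and M :: "'m topology"
  assumes M: "metrizable_space M" and f: "continuous_map T M f"
  obtains M' :: "'a topology" and f' r where "metrizable_space M'" "continuous_map T M' f'"
    "continuous_map M' M r" "\<And>x. x \<in> topspace T \<Longrightarrow> f x = r (f' x)"
proof -
  define Y where "Y = subtopology M (f ` topspace T)"
  define h where "h = inv_into (topspace T) f"
  define M' where "M' = pullback_topology (h ` topspace Y) f Y"
  have top: "topspace Y = f ` topspace T"
    using continuous_map_image_subset_topspace [OF f] by (auto simp: Y_def)
  have hm: "homeomorphic_maps Y M' h f"
    unfolding M'_def
    by (rule homeomorphic_maps_pullback) (auto simp: top h_def f_inv_into_f)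
  show thesis
  proof
    have "Y homeomorphic_space M'"
      using hm homeomorphic_space_def by blast
    then show "metrizable_space M'"
      using homeomorphic_metrizable_space metrizable_space_subtopology [OF M]
      unfolding Y_def by blast
    have "continuous_map T Y f"
      using f by (simp add: Y_def continuous_map_in_subtopology)
    then show "continuous_map T M' (h \<circ> f)"
      using hm continuous_map_compose unfolding homeomorphic_maps_def by blast
    show "continuous_map M' M f"
      using hm unfolding homeomorphic_maps_def Y_def by (auto simp: continuous_map_in_subtopology)
    show "f x = f ((h \<circ> f) x)" if "x \<in> topspace T" for x
      using that by (simp add: h_def f_inv_into_f)
  qed
qed

lemma m_factorizable_any_type:
  fixes G :: "('a, 'b) monoid_scheme" and M :: "'m topology"
  assumes "topological_group G T" "m_factorizable G T" "metrizable_space M" "continuous_map T M f"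
  shows "\<exists>(K :: 'a monoid) S \<pi> g. continuous_factorization G T M f K S \<pi> g"
proof -
  obtain M' :: "'a topology" and f' r where *: "metrizable_space M'" "continuous_map T M' f'"
    "continuous_map M' M r" "\<And>x. x \<in> topspace T \<Longrightarrow> f x = r (f' x)"
    using metrizable_target_copy assms(3,4) by metis
  obtain K :: "'a monoid" and S \<pi> g where "continuous_factorization G T M' f' K S \<pi> g"
    using assms(2) *(1,2) unfolding m_factorizable_def by blast
  then have "continuous_factorization G T M f K S \<pi> (r \<circ> g)"
    using *(3,4) continuous_map_compose [of S M' g M r] topological_group.topspace_eq [OF assms(1)]
    by (auto simp: continuous_factorization_def)
  then show ?thesis by blast
qed

lemma Pm_factorizable_any_type:
  fixes G :: "('a, 'b) monoid_scheme" and M :: "'m topology"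
  assumes "topological_group G T" "Pm_factorizable G T" "metrizable_space M" "continuous_map T M f"
  shows "\<exists>(K :: 'a monoid) S \<pi> g. continuous_factorization G T M f K S \<pi> g \<and> perfect_map T S \<pi>"
proof -
  obtain M' :: "'a topology" and f' r where *: "metrizable_space M'" "continuous_map T M' f'"
    "continuous_map M' M r" "\<And>x. x \<in> topspace T \<Longrightarrow> f x = r (f' x)"
    using metrizable_target_copy assms(3,4) by metis
  obtain K :: "'a monoid" and S \<pi> g
    where **: "continuous_factorization G T M' f' K S \<pi> g" "perfect_map T S \<pi>"
    using assms(2) *(1,2) unfolding Pm_factorizable_def by blast
  then have "continuous_factorization G T M f K S \<pi> (r \<circ> g)"
    using *(3,4) continuous_map_compose [of S M' g M r] topological_group.topspace_eq [OF assms(1)]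
    by (auto simp: continuous_factorization_def)
  then show ?thesis using **(2) by blast
qed

lemma topological_group_copy:
  fixes K :: "'k monoid" and s :: "'k \<Rightarrow> 'a"
  assumes K: "topological_group K S" and s: "inj_on s (carrier K)"
  obtains K' :: "'a monoid" and S' r where "topological_group K' S'" "s \<in> iso K K'"
    "homeomorphic_maps S S' s r"
proof -
  interpret K: topological_group K S by fact
  define r where "r = inv_into (carrier K) s"
  define K' where "K' = \<lparr>carrier = s ` carrier K,
    monoid.mult = (\<lambda>x y. s (r x \<otimes>\<^bsub>K\<^esub> r y)), one = s \<one>\<^bsub>K\<^esub>\<rparr>"
  define S' where "S' = pullback_topology (s ` carrier K) r S"
  have rs [simp]: "r (s x) = x" if "x \<in> carrier K" for x
    using s that by (simp add: r_def)
  have car: "carrier K' = s ` carrier K" and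
    mul: "\<And>x y. x \<otimes>\<^bsub>K'\<^esub> y = s (r x \<otimes>\<^bsub>K\<^esub> r y)" and one: "\<one>\<^bsub>K'\<^esub> = s \<one>\<^bsub>K\<^esub>"
    by (simp_all add: K'_def)
  have hm: "homeomorphic_maps S S' s r"
    unfolding S'_def by (rule homeomorphic_maps_pullback) (auto simp: K.topspace_eq)
  then have cs: "continuous_map S S' s" and cr: "continuous_map S' S r"
    by (auto simp: homeomorphic_maps_def)
  have top: "topspace S' = s ` carrier K"
    by (auto simp: S'_def topspace_pullback_topology K.topspace_eq)
  have grp: "group K'"
  proof (rule groupI)
    fix x assume "x \<in> carrier K'"
    then obtain a where a: "a \<in> carrier K" "x = s a" by (auto simp: car)
    show "\<exists>y\<in>carrier K'. y \<otimes>\<^bsub>K'\<^esub> x = \<one>\<^bsub>K'\<^esub>"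
      by (rule bexI [of _ "s (inv\<^bsub>K\<^esub> a)"]) (use a in \<open>auto simp: car mul one\<close>)
  qed (auto simp: car mul one K.m_assoc)
  have iso: "s \<in> iso K K'"
    using s by (auto simp: iso_def hom_def bij_betw_def car mul)
  have inv: "inv\<^bsub>K'\<^esub> x = s (inv\<^bsub>K\<^esub> (r x))" if "x \<in> carrier K'" for x
  proof (rule group.inv_equality [OF grp])
    show "s (inv\<^bsub>K\<^esub> (r x)) \<otimes>\<^bsub>K'\<^esub> x = \<one>\<^bsub>K'\<^esub>"
      using that by (auto simp: car mul one)
  qed (use that in \<open>auto simp: car\<close>)
  have "topological_group K' S'"
  proof (intro topological_group.intro topological_group_axioms.intro grp)
    show "topspace S' = carrier K'" by (simp add: top car)
    have "continuous_map (prod_topology S' S') (prod_topology S S) (\<lambda>(x, y). (r x, r y))"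
      using cr by (simp add: continuous_map_prod_top)
    from continuous_map_compose [OF continuous_map_compose [OF this K.continuous_mult] cs]
    show "continuous_map (prod_topology S' S') S' (\<lambda>(x, y). x \<otimes>\<^bsub>K'\<^esub> y)"
      by (simp add: mul o_def case_prod_unfold)
    show "continuous_map S' S' (\<lambda>x. inv\<^bsub>K'\<^esub> x)"
      by (rule continuous_map_eq
            [OF continuous_map_compose [OF continuous_map_compose [OF cr K.continuous_inv] cs]])
        (auto simp: inv top car)
    show "Hausdorff_space S'"
      using hm K.Hausdorff homeomorphic_Hausdorff_space homeomorphic_space_def by blast
  qed
  then show thesis using that iso hm by blast
qed

lemma continuous_factorization_copy:
  fixes G :: "('a, 'b) monoid_scheme" and K :: "'k monoid"
  assumes G: "topological_group G T" and fac: "continuous_factorization G T M f K S \<pi> g"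
  obtains K' :: "'a monoid" and S' \<pi>' g' where "continuous_factorization G T M f K' S' \<pi>' g'"
    "perfect_map T S \<pi> \<Longrightarrow> perfect_map T S' \<pi>'"
proof -
  have K: "topological_group K S" and sc: "second_countable S"
    and hom: "\<pi> \<in> hom G K" and cont: "continuous_map T S \<pi>" and onto: "\<pi> ` carrier G = carrier K"
    and g: "continuous_map S M g" and eq: "\<And>x. x \<in> carrier G \<Longrightarrow> f x = g (\<pi> x)"
    using fac by (auto simp: continuous_factorization_def)
  have "inj_on (inv_into (carrier G) \<pi>) (carrier K)"
    using onto by (metis inj_on_inv_into order_refl)
  then obtain K' :: "'a monoid" and S' r s where K': "topological_group K' S'" "s \<in> iso K K'"
    "homeomorphic_maps S S' s r"
    using topological_group_copy [OF K] by metis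
  have s: "homeomorphic_map S S' s" and cs: "continuous_map S S' s" and cr: "continuous_map S' S r"
    and rs: "\<And>x. x \<in> topspace S \<Longrightarrow> r (s x) = x"
    using K'(3) homeomorphic_maps_map by (auto simp: homeomorphic_maps_def)
  show thesis
  proof
    show "continuous_factorization G T M f K' S' (s \<circ> \<pi>) (g \<circ> r)"
      unfolding continuous_factorization_def
    proof (intro conjI ballI)
      show "second_countable S'"
        using sc K'(3) homeomorphic_space_second_countability homeomorphic_space_def by blast
      show "s \<circ> \<pi> \<in> hom G K'"
        using hom K'(2) by (auto simp: iso_def hom_def Pi_iff)
      show "(s \<circ> \<pi>) ` carrier G = carrier K'"
        using K'(2) onto unfolding iso_def bij_betw_def image_comp [symmetric] by simp
      show "f x = (g \<circ> r) ((s \<circ> \<pi>) x)" if "x \<in> carrier G" for x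
        using that rs [of "\<pi> x"] imageI [OF that, of \<pi>] onto topological_group.topspace_eq [OF K]
        by (simp add: eq)
    qed (use K'(1) cont cs cr g in \<open>auto intro: continuous_map_compose\<close>)
    show "perfect_map T S' (s \<circ> \<pi>)" if "perfect_map T S \<pi>"
      using that homeomorphic_imp_perfect_map [OF s] unfolding perfect_map_def
      by (metis continuous_map_compose proper_map_compose image_comp)
  qed
qed

lemma m_factorizableI_any_type:
  fixes G :: "('a, 'b) monoid_scheme"
  assumes "topological_group G T"
    and "\<And>(M :: 'a topology) f. metrizable_space M \<Longrightarrow> continuous_map T M f \<Longrightarrow>
      \<exists>(K :: 'k monoid) S \<pi> g. continuous_factorization G T M f K S \<pi> g"
  shows "m_factorizable G T"
  unfolding m_factorizable_def
proof (intro allI impI, elim conjE)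
  fix M :: "'a topology" and f
  assume "metrizable_space M" "continuous_map T M f"
  then obtain K :: "'k monoid" and S \<pi> g
    where *: "continuous_factorization G T M f K S \<pi> g"
    using assms(2) by blast
  show "\<exists>(K :: 'a monoid) S \<pi> g. continuous_factorization G T M f K S \<pi> g"
    by (rule continuous_factorization_copy [OF assms(1) *]) (use * in blast)
qed

lemma Pm_factorizableI_any_type:
  fixes G :: "('a, 'b) monoid_scheme"
  assumes "topological_group G T"
    and "\<And>(M :: 'a topology) f. metrizable_space M \<Longrightarrow> continuous_map T M f \<Longrightarrow>
      \<exists>(K :: 'k monoid) S \<pi> g. continuous_factorization G T M f K S \<pi> g \<and> perfect_map T S \<pi>"
  shows "Pm_factorizable G T"
  unfolding Pm_factorizable_def
proof (intro allI impI, elim conjE)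
  fix M :: "'a topology" and f
  assume "metrizable_space M" "continuous_map T M f"
  then obtain K :: "'k monoid" and S \<pi> g
    where *: "continuous_factorization G T M f K S \<pi> g" "perfect_map T S \<pi>"
    using assms(2) by blast
  show "\<exists>(K :: 'a monoid) S \<pi> g. continuous_factorization G T M f K S \<pi> g \<and> perfect_map T S \<pi>"
    by (rule continuous_factorization_copy [OF assms(1) *(1)]) (use * in blast)
qed

end

theory Submission
  imports Defs
begin

text \<open>
  If \<open>\<pi> : G \<rightarrow> K\<close> is perfect with \<open>K\<close> second countable, the preimages of a countable base at a point
  form a countable base at its compact fibre.  Conversely, let \<open>C\<close> be compact with a countable base
  \<open>U\<^sub>n\<close> of neighbourhoods and let \<open>c \<in> C\<close>.  As topological groups are completely regular, there are
  continuous \<open>u\<^sub>n : G \<rightarrow> [0,1]\<close> with \<open>u\<^sub>n c = 0\<close> and \<open>u\<^sub>n = 1\<close> off \<open>U\<^sub>n\<close>.  Factor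
  \<open>(f, u\<^sub>0, u\<^sub>1, \<dots>)\<close> through \<open>\<pi> : G \<rightarrow> K\<close>.  Each \<open>U\<^sub>n\<close> then contains the preimage of a neighbourhood
  of \<open>\<pi> c\<close>, so the fibre over \<open>\<pi> c\<close> is a closed subset of \<open>C\<close>, and a compactness argument shows that
  preimages of neighbourhoods of \<open>\<pi> c\<close> form a base at that fibre.  By homogeneity \<open>\<pi>\<close> is perfect.
\<close>

section \<open>Complete regularity of topological groups\<close>

lemma dyadics_dense:
  fixes a b :: real
  assumes "0 \<le> a" "a < b"
  obtains d where "d \<in> dyadics" "a < d" "d < b"
proof -
  \<comment> \<open>The midpoint is straddled with a gap below half of \<open>b - a\<close>, so the
    upper fraction stays between \<open>a\<close> and \<open>b\<close>.\<close>
  obtain n q r where "of_nat q / 2^n < (a + b) / 2" "(a + b) / 2 < of_nat r / 2^n"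
    "\<bar>q / 2^n - r / 2^n\<bar> < (b - a) / 2"
    by (rule padic_rational_approximation_straddle_pos [of "(b - a) / 2" 2 "(a + b) / 2"])
      (use assms in auto)
  moreover have "real r / 2^n \<in> dyadics"
    by (auto simp: dyadics_def)
  ultimately show thesis
    using that [of "real r / 2^n"] by (simp add: field_simps abs_if split: if_splits)
qed

text \<open>This is Urysohn's construction: the value at \<open>x\<close> is the infimum of the
  indices at which \<open>x\<close> belongs to the increasing family \<open>H\<close>. The inserted
  1 caps the value and keeps the infimum away from the empty set.\<close>

lemma continuous_map_dyadic_Inf:
  fixes H :: "real \<Rightarrow> 'a set" and X :: "'a topology"
  defines "D \<equiv> dyadics \<inter> {0..1::real}"
  assumes H: "\<And>r s. \<lbrakk>r \<in> D; s \<in> D; r < s\<rbrakk> \<Longrightarrow> X closure_of H r \<subseteq> X interior_of H s"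
    and sub: "\<And>r. r \<in> D \<Longrightarrow> H r \<subseteq> topspace X"
  shows "continuous_map X euclideanreal (\<lambda>x. Inf (insert 1 {r \<in> D. x \<in> H r}))"
proof -
  define f where "f = (\<lambda>x. Inf (insert 1 {r \<in> D. x \<in> H r}))"
  have bdd: "bdd_below (insert 1 {r \<in> D. x \<in> H r})" for x
    by (rule bdd_belowI [of _ 0]) (auto simp: D_def)
  have fle1: "f x \<le> 1" for x
    unfolding f_def by (rule cInf_lower [OF _ bdd]) simp
  have fle: "f x \<le> r" if "r \<in> D" "x \<in> H r" for x r
    unfolding f_def by (rule cInf_lower [OF _ bdd]) (use that in simp)
  have f_ge0: "0 \<le> f x" for x
    unfolding f_def by (rule cInf_greatest) (auto simp: D_def)
  have mono: "H r \<subseteq> H s" if "r \<in> D" "s \<in> D" "r < s" for r s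
    using H [OF that] closure_of_subset [OF sub [OF that(1)]] interior_of_subset [of X "H s"] by blast
  have f_ge: "r \<le> f x" if "r \<in> D" "x \<notin> H r" for x r
    unfolding f_def
  proof (rule cInf_greatest)
    fix s assume "s \<in> insert 1 {r \<in> D. x \<in> H r}"
    then show "r \<le> s"
      using that mono [of s r] by (force simp: D_def)
  qed simp
  have lower: "openin X {x \<in> topspace X. f x < t}" for t
  proof (subst openin_subopen, clarify)
    fix x assume x: "x \<in> topspace X" "f x < t"
    show "\<exists>U. openin X U \<and> x \<in> U \<and> U \<subseteq> {x \<in> topspace X. f x < t}"
    proof (cases "t > 1")
      case True
      then show ?thesis
        using x fle1 by (intro exI [of _ "topspace X"]) (auto intro: le_less_trans)
    next
      case False
      obtain r where r: "r \<in> D" "x \<in> H r" "r < t"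
        using cInf_lessD [of "insert 1 {r \<in> D. x \<in> H r}" t] x(2) False by (auto simp: f_def)
      \<comment> \<open>The interior of \<open>H s\<close> is a neighbourhood of \<open>x\<close> on
        which the function is at most \<open>s\<close>, hence below \<open>t\<close>.\<close>
      obtain s where s: "s \<in> dyadics" "r < s" "s < t"
        using dyadics_dense [of r t] r by (auto simp: D_def)
      then have sD: "s \<in> D"
        using r False by (auto simp: D_def)
      have "x \<in> X interior_of H s"
        using H [OF r(1) sD s(2)] r(2) closure_of_subset [OF sub [OF r(1)]] by blast
      moreover have "X interior_of H s \<subseteq> {x \<in> topspace X. f x < t}"
        using fle [OF sD] s(3) interior_of_subset [of X "H s"] sub [OF sD] by fastforce
      ultimately show ?thesis
        using openin_interior_of by blast
    qed
  qed
  have upper: "openin X {x \<in> topspace X. f x > t}" for t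
  proof (subst openin_subopen, clarify)
    fix x assume x: "x \<in> topspace X" "t < f x"
    show "\<exists>U. openin X U \<and> x \<in> U \<and> U \<subseteq> {x \<in> topspace X. f x > t}"
    proof (cases "t < 0")
      case True
      then show ?thesis
        using x f_ge0 by (intro exI [of _ "topspace X"]) (auto intro: less_le_trans)
    next
      case False
      \<comment> \<open>Two indices fit between \<open>t\<close> and \<open>f x\<close>. As
        \<open>x\<close> lies outside \<open>H s\<close>, it lies outside the closure of
        \<open>H r\<close>, and off that closure the function is at least \<open>r\<close>, hence
        above \<open>t\<close>.\<close>
      obtain r where r: "r \<in> dyadics" "t < r" "r < f x"
        using dyadics_dense [of t "f x"] x False by auto
      obtain s where s: "s \<in> dyadics" "r < s" "s < f x"
        using dyadics_dense [of r "f x"] r False by auto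
      have rD: "r \<in> D" and sD: "s \<in> D"
        using r s False fle1 [of x] by (auto simp: D_def)
      have "x \<notin> X closure_of H r"
        using H [OF rD sD s(2)] fle [OF sD, of x] s(3) interior_of_subset [of X "H s"] by force
      moreover have "topspace X - X closure_of H r \<subseteq> {x \<in> topspace X. f x > t}"
        using f_ge [OF rD] r(2) closure_of_subset [OF sub [OF rD]] by fastforce
      ultimately show ?thesis
        using x(1) by (intro exI [of _ "topspace X - X closure_of H r"]) auto
    qed
  qed
  show ?thesis
    unfolding f_def [symmetric] continuous_map_upper_lower_semicontinuous_lt
    using lower upper by blast
qed

context topological_group
begin

lemma continuous_map_left_translation:
  assumes "a \<in> carrier G"
  shows "continuous_map T T (\<lambda>x. a \<otimes> x)"
proof -
  have "continuous_map T (prod_topology T T) (\<lambda>x. (a, x))"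
    using assms topspace_eq by (intro continuous_map_pairedI) auto
  from continuous_map_compose [OF this continuous_mult] show ?thesis
    by (simp add: o_def)
qed

lemma openin_left_translation:
  assumes "openin T U" "a \<in> carrier G"
  shows "openin T {x \<in> carrier G. a \<otimes> x \<in> U}"
  using openin_continuous_map_preimage [OF continuous_map_left_translation [OF assms(2)] assms(1)]
  by (simp add: topspace_eq)

lemma openin_subset_carrier: "openin T U \<Longrightarrow> U \<subseteq> carrier G"
  using openin_subset topspace_eq by blast

lemma neighbourhood_one_square:
  assumes "openin T V" "\<one> \<in> V"
  obtains W where "openin T W" "\<one> \<in> W" "\<And>x y. \<lbrakk>x \<in> W; y \<in> W\<rbrakk> \<Longrightarrow> x \<otimes> y \<in> V"
proof -
  have "openin (prod_topology T T) {p \<in> topspace (prod_topology T T). (\<lambda>(x, y). x \<otimes> y) p \<in> V}"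
    using openin_continuous_map_preimage [OF continuous_mult assms(1)] .
  moreover have "(\<one>, \<one>) \<in> {p \<in> topspace (prod_topology T T). (\<lambda>(x, y). x \<otimes> y) p \<in> V}"
    using assms topspace_eq by auto
  ultimately obtain A B where "openin T A" "openin T B" "\<one> \<in> A" "\<one> \<in> B"
    and AB: "A \<times> B \<subseteq> {p \<in> topspace (prod_topology T T). (\<lambda>(x, y). x \<otimes> y) p \<in> V}"
    unfolding openin_prod_topology_alt by meson
  then show thesis
    by (intro that [of "A \<inter> B"]) auto
qed

text \<open>If \<open>x\<close> is in the closure of \<open>A\<close>, its neighbourhood x V^{-1}
  meets \<open>A\<close> in some \<open>a\<close>. Then \<open>x\<close> lies in aV, which is open
  and contained in \<open>B\<close>.\<close>

lemma closure_subset_interior_of_mult: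
  assumes "A \<subseteq> carrier G" "B \<subseteq> carrier G" "openin T V" "\<one> \<in> V"
    and AV: "\<And>a v. \<lbrakk>a \<in> A; v \<in> V\<rbrakk> \<Longrightarrow> a \<otimes> v \<in> B"
  shows "T closure_of A \<subseteq> T interior_of B"
proof
  fix x assume x: "x \<in> T closure_of A"
  then have xG: "x \<in> carrier G"
    using closure_of_subset_topspace [of T A] topspace_eq by auto
  define V' where "V' = {z \<in> carrier G. inv z \<in> V}"
  have "openin T V'"
    using openin_continuous_map_preimage [OF continuous_inv assms(3)] topspace_eq
    by (simp add: V'_def)
  then have "openin T {z \<in> carrier G. inv x \<otimes> z \<in> V'}"
    using openin_left_translation xG by blast
  moreover have "x \<in> {z \<in> carrier G. inv x \<otimes> z \<in> V'}"
    using xG assms(4) by (simp add: V'_def)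
  ultimately have "\<exists>a. a \<in> A \<and> a \<in> {z \<in> carrier G. inv x \<otimes> z \<in> V'}"
    using x unfolding in_closure_of by meson
  then obtain a where a: "a \<in> A" "inv x \<otimes> a \<in> V'"
    by auto
  have aG: "a \<in> carrier G"
    using a assms(1) by blast
  have "inv a \<otimes> x \<in> V"
    using a(2) aG xG by (simp add: V'_def inv_mult_group)
  moreover have "openin T {z \<in> carrier G. inv a \<otimes> z \<in> V}"
    using openin_left_translation assms(3) aG by blast
  moreover have "{z \<in> carrier G. inv a \<otimes> z \<in> V} \<subseteq> B"
  proof clarify
    fix z assume z: "z \<in> carrier G" "inv a \<otimes> z \<in> V"
    have "a \<otimes> (inv a \<otimes> z) \<in> B"
      using AV a(1) z(2) by blast
    then show "z \<in> B"
      using z(1) aG by (simp add: m_assoc [symmetric])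
  qed
  ultimately show "x \<in> T interior_of B"
    using xG unfolding interior_of_def by blast
qed

theorem completely_regular_space: "completely_regular_space T"
  unfolding completely_regular_space_def
proof (intro allI impI, elim conjE)
  fix S c assume S: "closedin T S" and "c \<in> topspace T - S"
  then have c: "c \<in> carrier G" "c \<notin> S"
    using topspace_eq by auto
  define U where "U = carrier G - S"
  have U: "openin T U"
    using S topspace_eq by (auto simp: U_def closedin_def)
  \<comment> \<open>\<open>R A B\<close> says that AV is contained in \<open>B\<close> for some
    neighbourhood V of the identity. This uniform inclusion can be interpolated without normality,
    and it forces the closure of \<open>A\<close> into the interior of \<open>B\<close>.\<close>
  define R where "R A B \<longleftrightarrow> A \<subseteq> carrier G \<and> B \<subseteq> carrier G \<and>
      (\<exists>V. openin T V \<and> \<one> \<in> V \<and> (\<forall>a\<in>A. \<forall>v\<in>V. a \<otimes> v \<in> B))" for A B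
  have "\<exists>H :: real \<Rightarrow> 'a set. H 0 = {c} \<and> H 1 = U \<and>
      (\<forall>x \<in> dyadics \<inter> {0..1}. \<forall>y \<in> dyadics \<inter> {0..1}. x < y \<longrightarrow> R (H x) (H y))"
  proof (rule recursion_on_dyadic_fractions)
    have "openin T {x \<in> carrier G. c \<otimes> x \<in> U}"
      using openin_left_translation U c by blast
    then show "R {c} U"
      using c unfolding R_def
      by (auto simp: U_def intro!: exI [of _ "{x \<in> carrier G. c \<otimes> x \<in> U}"])
  next
    fix A B assume "R A B"
    then obtain V where V: "A \<subseteq> carrier G" "B \<subseteq> carrier G" "openin T V" "\<one> \<in> V"
      "\<And>a v. \<lbrakk>a \<in> A; v \<in> V\<rbrakk> \<Longrightarrow> a \<otimes> v \<in> B"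
      unfolding R_def by blast
    obtain W where W: "openin T W" "\<one> \<in> W" "\<And>x y. \<lbrakk>x \<in> W; y \<in> W\<rbrakk> \<Longrightarrow> x \<otimes> y \<in> V"
      using neighbourhood_one_square [OF V(3,4)] by blast
    have WG: "W \<subseteq> carrier G"
      using openin_subset_carrier W(1) .
    \<comment> \<open>The interpolant is AW with WW inside V: then AW lies in \<open>M\<close>, and
      MW = AWW lies in AV, hence in \<open>B\<close>.\<close>
    define M where "M = {a \<otimes> w | a w. a \<in> A \<and> w \<in> W}"
    have "M \<subseteq> carrier G"
      using V(1) WG by (auto simp: M_def)
    moreover have "a \<otimes> w \<otimes> w' \<in> B" if "a \<in> A" "w \<in> W" "w' \<in> W" for a w w'
      using V(5) [OF that(1) W(3) [OF that(2,3)]] that V(1) WG by (simp add: m_assoc subsetD)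
    ultimately have "R A M" "R M B"
      using V(1,2) W(1,2) unfolding R_def by (auto simp: M_def)
    then show "\<exists>M. R A M \<and> R M B"
      by blast
  next
    fix A B C assume AB: "R A B" and BC: "R B C"
    have "A \<subseteq> B"
    proof
      fix a assume "a \<in> A"
      with AB have "a \<otimes> \<one> \<in> B" "a \<in> carrier G"
        unfolding R_def by auto
      then show "a \<in> B"
        by simp
    qed
    then show "R A C"
      using AB BC unfolding R_def by blast
  qed
  then obtain H :: "real \<Rightarrow> 'a set" where H0: "H 0 = {c}" and H1: "H 1 = U"
    and H: "\<And>x y. \<lbrakk>x \<in> dyadics \<inter> {0..1}; y \<in> dyadics \<inter> {0..1}; x < y\<rbrakk> \<Longrightarrow> R (H x) (H y)"
    by blast
  have 0: "0 \<in> dyadics \<inter> {0..1::real}" and 1: "1 \<in> dyadics \<inter> {0..1::real}"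
    by (force simp: dyadics_def)+
  define f where "f = (\<lambda>x. Inf (insert 1 {r \<in> dyadics \<inter> {0..1::real}. x \<in> H r}))"
  have sub: "H r \<subseteq> topspace T" if "r \<in> dyadics \<inter> {0..1}" for r
  proof (cases "r = 1")
    case True
    then show ?thesis
      using H1 U openin_subset by blast
  next
    case False
    then show ?thesis
      using H [OF that 1] that by (auto simp: R_def topspace_eq)
  qed
  have "continuous_map T euclideanreal f"
    unfolding f_def
  proof (rule continuous_map_dyadic_Inf)
    fix r s :: real
    assume "r \<in> dyadics \<inter> {0..1}" "s \<in> dyadics \<inter> {0..1}" "r < s"
    then have "R (H r) (H s)"
      by (rule H)
    then show "T closure_of H r \<subseteq> T interior_of H s"
      using closure_subset_interior_of_mult unfolding R_def by meson
  qed (rule sub)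
  moreover have "f x \<in> {0..1}" for x
  proof -
    have "bdd_below (insert 1 {r \<in> dyadics \<inter> {0..1::real}. x \<in> H r})"
      by (rule bdd_belowI [of _ 0]) auto
    then have "f x \<le> 1"
      unfolding f_def by (intro cInf_lower) auto
    moreover have "0 \<le> f x"
      unfolding f_def by (rule cInf_greatest) auto
    ultimately show ?thesis
      by simp
  qed
  ultimately have "continuous_map T (top_of_set {0..1}) f"
    by (auto simp: continuous_map_in_subtopology)
  moreover have "f c = 0"
    unfolding f_def by (rule cInf_eq_minimum) (use 0 H0 in auto)
  moreover have "f x = 1" if "x \<in> S" for x
  proof -
    have xU: "x \<notin> U"
      using that by (simp add: U_def)
    \<comment> \<open>Every \<open>H r\<close> lies in \<open>U\<close>, so on \<open>S\<close> only
      the inserted 1 is left in the infimum.\<close>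
    have "x \<notin> H r" if r: "r \<in> dyadics \<inter> {0..1}" for r
    proof (cases "r = 1")
      case False
      then have R: "R (H r) U"
        using H [OF r 1] r H1 by auto
      have "T closure_of H r \<subseteq> T interior_of U"
        using R closure_subset_interior_of_mult unfolding R_def by meson
      then show ?thesis
        using xU closure_of_subset [OF sub [OF r]] interior_of_subset [of T U] by blast
    qed (use xU H1 in simp)
    then have "{r \<in> dyadics \<inter> {0..1}. x \<in> H r} = {}"
      by blast
    then show ?thesis
      unfolding f_def by (metis cInf_singleton)
  qed
  ultimately show "\<exists>f::'a \<Rightarrow> real. continuous_map T (top_of_set {0..1}) f \<and> f c = 0 \<and> f ` S \<subseteq> {1}"
    by blast
qed

section \<open>Perfect homomorphisms\<close>

text \<open>Left translations of both groups are homeomorphisms compatible with \<open>\<pi>\<close>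
  and act transitively on the fibres. Compactness and the neighbourhood property therefore pass from
  one fibre to all, and the latter property at every fibre means that \<open>\<pi>\<close> is
  closed.\<close>

lemma perfect_map_hom_if_fibre:
  assumes K: "topological_group K S" and hom: "\<pi> \<in> hom G K"
    and cont: "continuous_map T S \<pi>" and onto: "\<pi> ` carrier G = carrier K"
    and c: "c \<in> carrier G" and compact: "compactin T {x \<in> carrier G. \<pi> x = \<pi> c}"
    and base: "\<And>V. \<lbrakk>openin T V; {x \<in> carrier G. \<pi> x = \<pi> c} \<subseteq> V\<rbrakk> \<Longrightarrow>
      \<exists>W. openin S W \<and> \<pi> c \<in> W \<and> {x \<in> carrier G. \<pi> x \<in> W} \<subseteq> V"
  shows "perfect_map T S \<pi>"
proof -
  interpret K: topological_group K S by fact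
  interpret \<pi>: group_hom G K \<pi>
    using hom K.is_group is_group by (simp add: group_hom_def group_hom_axioms_def)
  have compact_fibre: "compactin T {z \<in> topspace T. \<pi> z = y}" if y: "y \<in> topspace S" for y
  proof -
    obtain x where x: "x \<in> carrier G" "y = \<pi> x"
      using y onto K.topspace_eq by blast
    \<comment> \<open>Translation by \<open>a\<close> moves \<open>c\<close> to \<open>x\<close>,
      hence the fibre over \<open>\<pi> c\<close> onto the fibre over \<open>y\<close>.\<close>
    define a where "a = x \<otimes> inv c"
    have a: "a \<in> carrier G"
      using x c by (simp add: a_def)
    have "(\<lambda>z. a \<otimes> z) ` {z \<in> carrier G. \<pi> z = \<pi> c} = {z \<in> topspace T. \<pi> z = y}"
    proof (intro equalityI subsetI)
      fix z assume "z \<in> (\<lambda>z. a \<otimes> z) ` {z \<in> carrier G. \<pi> z = \<pi> c}"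
      then show "z \<in> {z \<in> topspace T. \<pi> z = y}"
        using a x c by (auto simp: topspace_eq a_def K.m_assoc)
    next
      fix z assume z: "z \<in> {z \<in> topspace T. \<pi> z = y}"
      show "z \<in> (\<lambda>z. a \<otimes> z) ` {z \<in> carrier G. \<pi> z = \<pi> c}"
      proof
        show "z = a \<otimes> (inv a \<otimes> z)"
          using z a by (simp add: topspace_eq m_assoc [symmetric])
        show "inv a \<otimes> z \<in> {z \<in> carrier G. \<pi> z = \<pi> c}"
          using z a x c by (simp add: topspace_eq a_def inv_mult_group K.m_assoc)
      qed
    qed
    then show ?thesis
      using image_compactin [OF compact continuous_map_left_translation [OF a]] by simp
  qed
  have "closed_map T S \<pi>"
    unfolding closed_map_fibre_neighbourhood imp_conjL
  proof (intro conjI strip)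
    show "\<pi> \<in> topspace T \<rightarrow> topspace S"
      using cont continuous_map_funspace by blast
    fix U y
    assume U: "openin T U" and y: "y \<in> topspace S" and sub: "{x \<in> topspace T. \<pi> x = y} \<subseteq> U"
    obtain x where x: "x \<in> carrier G" "y = \<pi> x"
      using y onto K.topspace_eq by blast
    define a where "a = x \<otimes> inv c"
    have a: "a \<in> carrier G"
      using x c by (simp add: a_def)
    have "{z \<in> carrier G. \<pi> z = \<pi> c} \<subseteq> {z \<in> carrier G. a \<otimes> z \<in> U}"
      using sub a x c by (auto simp: topspace_eq a_def K.m_assoc intro!: subsetD [OF sub])
    then obtain W where W: "openin S W" "\<pi> c \<in> W"
      and WU: "{z \<in> carrier G. \<pi> z \<in> W} \<subseteq> {z \<in> carrier G. a \<otimes> z \<in> U}"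
      using base openin_left_translation [OF U a] by meson
    show "\<exists>V. openin S V \<and> y \<in> V \<and> {x \<in> topspace T. \<pi> x \<in> V} \<subseteq> U"
    proof (intro exI conjI)
      \<comment> \<open>This set is the translate of \<open>W\<close> by \<open>\<pi> a\<close>: the
        neighbourhood found at \<open>\<pi> c\<close> is moved to \<open>y\<close>.\<close>
      show "openin S {k \<in> carrier K. \<pi> (inv a) \<otimes>\<^bsub>K\<^esub> k \<in> W}"
        using K.openin_left_translation W(1) a by simp
      show "y \<in> {k \<in> carrier K. \<pi> (inv a) \<otimes>\<^bsub>K\<^esub> k \<in> W}"
        using W(2) x c by (simp add: a_def inv_mult_group K.m_assoc)
      show "{x \<in> topspace T. \<pi> x \<in> {k \<in> carrier K. \<pi> (inv a) \<otimes>\<^bsub>K\<^esub> k \<in> W}} \<subseteq> U"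
      proof clarify
        fix z assume z: "z \<in> topspace T" "\<pi> (inv a) \<otimes>\<^bsub>K\<^esub> \<pi> z \<in> W"
        then have "inv a \<otimes> z \<in> {z \<in> carrier G. \<pi> z \<in> W}"
          using a by (simp add: topspace_eq)
        then have "a \<otimes> (inv a \<otimes> z) \<in> U"
          using WU by blast
        then show "z \<in> U"
          using z a by (simp add: topspace_eq m_assoc [symmetric])
      qed
    qed
  qed
  then show ?thesis
    unfolding perfect_map_def proper_map_def
    using cont compact_fibre onto topspace_eq K.topspace_eq by simp
qed

end

text \<open>The fibre lies in every member of \<open>\<U>\<close>, and these members shrink to
  \<open>C\<close>, so the fibre lies in \<open>C\<close>. Inside \<open>C\<close>, compactness
  separates the fibre's image from the image of what an open set \<open>V\<close> leaves
  out.\<close>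

lemma fibre_neighbourhoods_if_countable_character:
  assumes X: "Hausdorff_space X" and Y: "Hausdorff_space Y" and p: "continuous_map X Y p"
    and C: "compactin X C" and c: "c \<in> C"
    and U_char: "\<And>V. \<lbrakk>openin X V; C \<subseteq> V\<rbrakk> \<Longrightarrow> \<exists>U\<in>\<U>. U \<subseteq> V"
    and U_fibre: "\<And>U. U \<in> \<U> \<Longrightarrow> \<exists>W. openin Y W \<and> p c \<in> W \<and> {x \<in> topspace X. p x \<in> W} \<subseteq> U"
  shows "compactin X {x \<in> topspace X. p x = p c}"
    and "\<And>V. \<lbrakk>openin X V; {x \<in> topspace X. p x = p c} \<subseteq> V\<rbrakk> \<Longrightarrow>
      \<exists>W. openin Y W \<and> p c \<in> W \<and> {x \<in> topspace X. p x \<in> W} \<subseteq> V"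
proof -
  have pc: "p c \<in> topspace Y"
    using c C p compactin_subset_topspace continuous_map_funspace by blast
  have FU: "{x \<in> topspace X. p x = p c} \<subseteq> U" if U: "U \<in> \<U>" for U
  proof -
    obtain W where "p c \<in> W" "{x \<in> topspace X. p x \<in> W} \<subseteq> U"
      using U_fibre [OF U] by blast
    then show ?thesis
      by auto
  qed
  have FC: "{x \<in> topspace X. p x = p c} \<subseteq> C"
  proof (rule ccontr)
    assume "\<not> ?thesis"
    then obtain x where x: "x \<in> topspace X" "p x = p c" "x \<notin> C"
      by blast
    \<comment> \<open>Some member of \<open>\<U>\<close> would avoid \<open>x\<close>, although
      every member contains the whole fibre.\<close>
    have "openin X (topspace X - {x})"
      using closedin_Hausdorff_singleton [OF X x(1)] by blast
    moreover have "C \<subseteq> topspace X - {x}"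
      using x(3) C compactin_subset_topspace by blast
    ultimately show False
      using U_char FU x by blast
  qed
  have "closedin X {x \<in> topspace X. p x \<in> {p c}}"
    using closedin_continuous_map_preimage [OF p closedin_Hausdorff_singleton [OF Y pc]] .
  then show "compactin X {x \<in> topspace X. p x = p c}"
    using closed_compactin [OF C FC] by simp
  fix V assume V: "openin X V" "{x \<in> topspace X. p x = p c} \<subseteq> V"
  have CV: "compactin X (C - V)"
  proof (rule closed_compactin [OF C])
    have "C - V = C \<inter> (topspace X - V)"
      using compactin_subset_topspace [OF C] by blast
    then show "closedin X (C - V)"
      using closedin_Int compactin_imp_closedin [OF X C] V(1) by auto
  qed blast
  \<comment> \<open>The compact image of \<open>C - V\<close> misses \<open>p c\<close>, so disjoint
    open sets \<open>W\<close> and \<open>Q\<close> separate them. Adding the preimage of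
    \<open>Q\<close> to \<open>V\<close> then covers \<open>C\<close>.\<close>
  have "disjnt {p c} (p ` (C - V))"
    using V(2) C compactin_subset_topspace by (fastforce simp: disjnt_iff)
  then obtain W Q where WQ: "openin Y W" "openin Y Q" "p c \<in> W" "p ` (C - V) \<subseteq> Q" "disjnt W Q"
    using Hausdorff_space_compact_separation [OF Y _ image_compactin [OF CV p], of "{p c}"] pc
    by auto
  have "openin X (V \<union> {x \<in> topspace X. p x \<in> Q})"
    using V(1) openin_continuous_map_preimage [OF p WQ(2)] by blast
  moreover have "C \<subseteq> V \<union> {x \<in> topspace X. p x \<in> Q}"
    using WQ(4) C compactin_subset_topspace by blast
  ultimately obtain U where U: "U \<in> \<U>" "U \<subseteq> V \<union> {x \<in> topspace X. p x \<in> Q}"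
    using U_char by blast
  obtain W' where W': "openin Y W'" "p c \<in> W'" "{x \<in> topspace X. p x \<in> W'} \<subseteq> U"
    using U_fibre [OF U(1)] by blast
  show "\<exists>W. openin Y W \<and> p c \<in> W \<and> {x \<in> topspace X. p x \<in> W} \<subseteq> V"
  \<comment> \<open>A point over \<open>W'\<close> lies in \<open>U\<close>, hence in
    \<open>V\<close> or over \<open>Q\<close>; being also over \<open>W\<close> excludes the
    latter.\<close>
  proof (intro exI conjI)
    show "openin Y (W \<inter> W')"
      using WQ W' by blast
    show "{x \<in> topspace X. p x \<in> W \<inter> W'} \<subseteq> V"
      using U(2) W'(3) WQ(5) unfolding disjnt_iff by blast
  qed (use WQ W' in blast)
qed

text \<open>For a closed map, every open set around a fibre contains the preimage of a neighbourhood
  of the base point. A countable local base downstairs thus pulls back to one at the compact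
  fibre.\<close>

lemma feathered_if_perfect_map:
  assumes p: "perfect_map X Y p" and Y: "first_countable Y" and ne: "topspace Y \<noteq> {}"
  shows "feathered X"
proof -
  have cont: "continuous_map X Y p" and closed: "closed_map X Y p"
    and onto: "p ` topspace X = topspace Y"
    and cpt: "\<And>y. y \<in> topspace Y \<Longrightarrow> compactin X {x \<in> topspace X. p x = y}"
    using p by (auto simp: perfect_map_def proper_map_def)
  obtain y where y: "y \<in> topspace Y"
    using ne by blast
  obtain \<B> where \<B>: "countable \<B>" "\<And>V. V \<in> \<B> \<Longrightarrow> openin Y V"
    "\<And>U. \<lbrakk>openin Y U; y \<in> U\<rbrakk> \<Longrightarrow> \<exists>V\<in>\<B>. y \<in> V \<and> V \<subseteq> U"
    using Y y unfolding first_countable_def by metis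
  define \<U> where "\<U> = (\<lambda>V. {x \<in> topspace X. p x \<in> V}) ` {V \<in> \<B>. y \<in> V}"
  show ?thesis
    unfolding feathered_def
  proof (intro exI conjI ballI allI impI)
    show "{x \<in> topspace X. p x = y} \<noteq> {}"
      using y onto by force
    show "compactin X {x \<in> topspace X. p x = y}"
      using cpt y .
    show "countable \<U>"
      unfolding \<U>_def using \<B>(1) by simp
    show "openin X U" "{x \<in> topspace X. p x = y} \<subseteq> U" if "U \<in> \<U>" for U
      using that \<B>(2) openin_continuous_map_preimage [OF cont] by (auto simp: \<U>_def)
    fix V assume "openin X V \<and> {x \<in> topspace X. p x = y} \<subseteq> V"
    then obtain W where W: "openin Y W" "y \<in> W" "{x \<in> topspace X. p x \<in> W} \<subseteq> V"
      using closed y unfolding closed_map_fibre_neighbourhood by meson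
    then obtain B where B: "B \<in> \<B>" "y \<in> B" "B \<subseteq> W"
      using \<B>(3) by blast
    show "\<exists>U\<in>\<U>. U \<subseteq> V"
    proof
      show "{x \<in> topspace X. p x \<in> B} \<in> \<U>"
        using B unfolding \<U>_def by simp
      show "{x \<in> topspace X. p x \<in> B} \<subseteq> V"
        using B(3) W(3) by auto
    qed
  qed
qed

section \<open>The characterization\<close>

lemma Pm_factorizable_imp_m_factorizable: "Pm_factorizable G T \<Longrightarrow> m_factorizable G T"
  unfolding Pm_factorizable_def m_factorizable_def by blast

lemma Pm_factorizable_imp_feathered:
  fixes G :: "('a, 'b) monoid_scheme"
  assumes G: "topological_group G T" and Pm: "Pm_factorizable G T"
  shows "feathered T"
proof -
  \<comment> \<open>A constant map suffices, since only the existence of a perfect homomorphism onto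
    a second-countable group is wanted.\<close>
  have "continuous_map T euclideanreal (\<lambda>x. 0)"
    by simp
  then obtain K :: "'a monoid" and S \<pi> g
    where fac: "continuous_factorization G T euclideanreal (\<lambda>x. 0) K S \<pi> g" and "perfect_map T S \<pi>"
    using Pm_factorizable_any_type [OF G Pm metrizable_space_euclidean] by blast
  moreover interpret K: topological_group K S
    using fac by (simp add: continuous_factorization_def)
  have "first_countable S" "topspace S \<noteq> {}"
    using fac second_countable_imp_first_countable K.topspace_eq
    by (auto simp: continuous_factorization_def)
  ultimately show ?thesis
    using feathered_if_perfect_map by blast
qed

lemma feathered_m_factorizable_imp_Pm_factorizable:
  fixes G :: "('a, 'b) monoid_scheme"
  assumes G: "topological_group G T" and "feathered T" and m: "m_factorizable G T"
  shows "Pm_factorizable G T"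
proof (rule Pm_factorizableI_any_type [OF G])
  interpret topological_group G T by fact
  fix M :: "'a topology" and f
  assume M: "metrizable_space M" and f: "continuous_map T M f"
  obtain C \<U> where C: "C \<noteq> {}" "compactin T C" and \<U>: "countable \<U>"
    and U_nhd: "\<forall>U\<in>\<U>. openin T U \<and> C \<subseteq> U"
    and U_base: "\<forall>V. openin T V \<and> C \<subseteq> V \<longrightarrow> (\<exists>U\<in>\<U>. U \<subseteq> V)"
    using \<open>feathered T\<close> unfolding feathered_def by (elim exE conjE) rule
  have U_open: "openin T U" and CU: "C \<subseteq> U" if "U \<in> \<U>" for U
    using U_nhd that by simp_all
  have U_char: "\<exists>U\<in>\<U>. U \<subseteq> V" if "openin T V" "C \<subseteq> V" for V
    using U_base that by simp
  obtain c where c: "c \<in> C"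
    using C by blast
  then have cG: "c \<in> carrier G"
    using C compactin_subset_topspace topspace_eq by blast
  \<comment> \<open>Complete regularity separates \<open>c\<close> from the complement of each
    \<open>U\<close>. These functions encode the countable base at \<open>C\<close> in a map to a
    metrizable space.\<close>
  have "\<forall>U\<in>\<U>. \<exists>u :: 'a \<Rightarrow> real. continuous_map T euclideanreal u \<and> u c = 0 \<and>
      (\<forall>x \<in> carrier G - U. u x = 1)"
  proof
    fix U assume U: "U \<in> \<U>"
    have "closedin T (topspace T - U)" "c \<in> topspace T - (topspace T - U)"
      using U_open [OF U] CU [OF U] c cG topspace_eq by (blast, auto)
    then obtain u :: "'a \<Rightarrow> real" where "continuous_map T (top_of_set {0..1}) u" "u c = 0"
      "u ` (topspace T - U) \<subseteq> {1}"
      using completely_regular_space unfolding completely_regular_space_def by meson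
    then show "\<exists>u :: 'a \<Rightarrow> real. continuous_map T euclideanreal u \<and> u c = 0 \<and>
        (\<forall>x \<in> carrier G - U. u x = 1)"
      using topspace_eq by (intro exI [of _ u]) (auto simp: continuous_map_in_subtopology)
  qed
  from bchoice [OF this] obtain u :: "'a set \<Rightarrow> 'a \<Rightarrow> real"
    where u_all: "\<forall>U\<in>\<U>. continuous_map T euclideanreal (u U) \<and> u U c = 0 \<and>
      (\<forall>x \<in> carrier G - U. u U x = 1)" ..
  then have u: "continuous_map T euclideanreal (u U)" and uc: "u U c = 0"
    and u1: "\<And>x. \<lbrakk>x \<in> carrier G; x \<notin> U\<rbrakk> \<Longrightarrow> u U x = 1" if "U \<in> \<U>" for U
    using that by simp_all
  \<comment> \<open>\<open>P\<close> is metrizable because there are only countably many real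
    coordinates. Its points have a type other than \<open>'a\<close>, hence the later appeal to
    \<open>m_factorizable_any_type\<close>.\<close>
  define P where "P = prod_topology M (product_topology (\<lambda>_. euclideanreal) \<U>)"
  define F where "F = (\<lambda>x. (f x, \<lambda>U\<in>\<U>. u U x))"
  have P: "metrizable_space P"
  proof -
    have "countable {U \<in> \<U>. \<not> (\<exists>a::real. UNIV \<subseteq> {a})}"
      by (rule countable_subset [OF _ \<U>]) blast
    then show ?thesis
      unfolding P_def using M
      by (simp add: metrizable_space_prod_topology metrizable_space_product_topology
          metrizable_space_euclidean)
  qed
  have "continuous_map T P F"
    unfolding P_def F_def using f u
    by (intro continuous_map_pairedI) (auto simp: continuous_map_componentwise)
  then obtain K :: "'a monoid" and S \<pi> g where fac: "continuous_factorization G T P F K S \<pi> g"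
    using m_factorizable_any_type [OF G m P] by blast
  then have K: "topological_group K S" and hom: "\<pi> \<in> hom G K" and \<pi>: "continuous_map T S \<pi>"
    and onto: "\<pi> ` carrier G = carrier K" and g: "continuous_map S P g"
    and Fg: "\<And>x. x \<in> carrier G \<Longrightarrow> F x = g (\<pi> x)"
    by (auto simp: continuous_factorization_def)
  have \<pi>S: "\<pi> x \<in> topspace S" if "x \<in> carrier G" for x
    using that \<pi> topspace_eq continuous_map_funspace by blast
  have fib: "\<exists>W. openin S W \<and> \<pi> c \<in> W \<and> {x \<in> topspace T. \<pi> x \<in> W} \<subseteq> U" if U: "U \<in> \<U>" for U
  proof -
    have "continuous_map P euclideanreal (\<lambda>z. snd z U)"
      unfolding P_def
      using continuous_map_compose [OF continuous_map_snd continuous_map_product_projection [OF U]]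
      by (simp add: o_def)
    then have h: "continuous_map S euclideanreal (\<lambda>k. snd (g k) U)"
      using continuous_map_compose [OF g] by (simp add: o_def)
    have hu: "snd (g (\<pi> x)) U = u U x" if "x \<in> carrier G" for x
      using Fg [OF that, symmetric] U by (simp add: F_def)
    \<comment> \<open>Over \<open>\<pi> x\<close> the coordinate of \<open>g\<close> at
      \<open>U\<close> equals \<open>u U x\<close>. It is 0 at \<open>c\<close> and 1 off
      \<open>U\<close>, so the bound 1 cuts out a neighbourhood of \<open>\<pi> c\<close> whose
      preimage lies in \<open>U\<close>.\<close>
    define W where "W = {k \<in> topspace S. snd (g k) U \<in> {..<1}}"
    have "openin S W"
      unfolding W_def using openin_continuous_map_preimage [OF h, of "{..<1}"] by simp
    moreover have "\<pi> c \<in> W"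
      using \<pi>S [OF cG] hu [OF cG] uc [OF U] by (simp add: W_def)
    moreover have "{x \<in> topspace T. \<pi> x \<in> W} \<subseteq> U"
      using u1 [OF U] hu topspace_eq by (force simp: W_def)
    ultimately show ?thesis
      by blast
  qed
  note fibre = fibre_neighbourhoods_if_countable_character
    [OF Hausdorff topological_group.Hausdorff [OF K] \<pi> C(2) c U_char fib, unfolded topspace_eq]
  have "perfect_map T S \<pi>"
    by (rule perfect_map_hom_if_fibre [OF K hom \<pi> onto cG fibre])
  \<comment> \<open>The same \<open>K\<close> and \<open>\<pi>\<close> serve for \<open>f\<close>,
    which is the first coordinate of \<open>F\<close>.\<close>
  moreover have "continuous_factorization G T M f K S \<pi> (fst \<circ> g)"
  proof -
    have "continuous_map S M (fst \<circ> g)"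
      using continuous_map_compose [OF g] continuous_map_fst unfolding P_def by blast
    moreover have "f x = (fst \<circ> g) (\<pi> x)" if "x \<in> carrier G" for x
      using Fg [OF that, symmetric] by (simp add: F_def)
    ultimately show ?thesis
      using fac by (simp add: continuous_factorization_def)
  qed
  ultimately show "\<exists>(K :: 'a monoid) S \<pi> g. continuous_factorization G T M f K S \<pi> g \<and> perfect_map T S \<pi>"
    by blast
qed

theorem corollary5p5:
  fixes G :: "('a, 'b) monoid_scheme" and T :: "'a topology"
  assumes "topological_group G T"
  shows "Pm_factorizable G T \<longleftrightarrow> feathered T \<and> m_factorizable G T"
  using assms Pm_factorizable_imp_feathered Pm_factorizable_imp_m_factorizable
    feathered_m_factorizable_imp_Pm_factorizable by blast

end
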